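(* For every graph $G$ with at least one edge, the rank polynomial $R(G;x,y)$ is reconstructible from $\mathcal{N}(G)$. That is, if $G,G'$ are graphs with at least one edge and $\mathcal{N}(G)=\mathcal{N}(G')$, then $R(G;x,y)=R(G';x,y)$.
   Context: All graphs are finite and simple. $\binom{G}{F}$ is the number of induced subgraphs of $G$ isomorphic to $F$. $\Lambda(G)=\{\Lambda_1,\dots,\Lambda_I\}$ is the set of distinct isomorphism types of induced subgraphs of $G$ having at least one edge (including $G$), and $\mathcal{N}(G)=(N_{ij})$ is the $I\times I$ matrix $N_{ij}=\binom{\Lambda_i}{\Lambda_j}$. It is unlabelled: the graphs $\Lambda_i$ are not given, so $\mathcal{N}(G)=\mathcal{N}(G')$ means equality up to applying one and the same permutation to rows and columns. For a graph $F$ with $v(F)$ vertices, $e(F)$ edges and $comp(F)$ connected components, the rank is $v(F)-comp(F)$ and the co-rank is $e(F)-v(F)+comp(F)$. The rank polynomial is $R(G;x,y)=\sum\rho_{rs}x^ry^s$, where $\rho_{rs}$ is the number of subgraphs of $G$ with rank $r$ and co-rank $s$; here the subgraphs counted are those without isolated vertices, equivalently the subsets of the edge set of $G$ (including the empty one). *)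

theory Defs
  imports "HOL-Combinatorics.Permutations" "HOL-Computational_Algebra.Polynomial"
    "Jordan_Normal_Form.Matrix"
begin

section \<open>Finite simple graphs\<close>

type_synonym 'a graph = "'a set \<times> 'a set set"

abbreviation verts :: "'a graph \<Rightarrow> 'a set" where "verts \<equiv> fst"
abbreviation edges :: "'a graph \<Rightarrow> 'a set set" where "edges \<equiv> snd"

definition simple_graph :: "'a graph \<Rightarrow> bool" where
  "simple_graph G \<longleftrightarrow> finite (verts G) \<and> (\<forall>e \<in> edges G. e \<subseteq> verts G \<and> card e = 2)"

definition graph_iso :: "'a graph \<Rightarrow> 'b graph \<Rightarrow> bool" where
  "graph_iso F H \<longleftrightarrow> (\<exists>f. bij_betw f (verts F) (verts H) \<and>
     (\<forall>u \<in> verts F. \<forall>v \<in> verts F. {u, v} \<in> edges F \<longleftrightarrow> {f u, f v} \<in> edges H))"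

definition induced :: "'a graph \<Rightarrow> 'a set \<Rightarrow> 'a graph" where
  "induced G W = (W, {e \<in> edges G. e \<subseteq> W})"

definition induced_subgraphs :: "'a graph \<Rightarrow> 'a graph set" where
  "induced_subgraphs G = {induced G W | W. W \<subseteq> verts G}"

definition induced_count :: "'a graph \<Rightarrow> 'b graph \<Rightarrow> nat" where
  "induced_count G F = card {H \<in> induced_subgraphs G. graph_iso H F}"


section \<open>The matrix of induced subgraph counts\<close>

text \<open>An enumeration \<open>\<Lambda>\<^sub>1, \<dots>, \<Lambda>\<^sub>I\<close> of the isomorphism types of induced subgraphs with at
  least one edge. Each type is given by a representative that is itself an induced subgraph
  of \<open>G\<close>; the list contains exactly one representative per type.\<close>

definition enumerates_Lambda :: "'a graph \<Rightarrow> 'a graph list \<Rightarrow> bool" where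
  "enumerates_Lambda G Fs \<longleftrightarrow>
     set Fs \<subseteq> {F \<in> induced_subgraphs G. edges F \<noteq> {}} \<and>
     (\<forall>F \<in> induced_subgraphs G. edges F \<noteq> {} \<longrightarrow> (\<exists>!i. i < length Fs \<and> graph_iso F (Fs ! i)))"

text \<open>\<open>is_N_matrix G M\<close>: \<open>M\<close> is the matrix \<open>\<N>(G)\<close> with respect to some enumeration of the types.\<close>

definition is_N_matrix :: "'a graph \<Rightarrow> nat mat \<Rightarrow> bool" where
  "is_N_matrix G M \<longleftrightarrow> (\<exists>Fs. enumerates_Lambda G Fs \<and>
     M = mat (length Fs) (length Fs) (\<lambda>(i, j). induced_count (Fs ! i) (Fs ! j)))"

text \<open>Equality of unlabelled square matrices: one permutation acts on rows and columns.\<close>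

definition unlabelled_eq :: "'c mat \<Rightarrow> 'c mat \<Rightarrow> bool" where
  "unlabelled_eq M M' \<longleftrightarrow> (\<exists>n p. M \<in> carrier_mat n n \<and> M' \<in> carrier_mat n n \<and>
     p permutes {..<n} \<and> (\<forall>i<n. \<forall>j<n. M' $$ (p i, p j) = M $$ (i, j)))"

text \<open>Every finite simple graph has such a matrix.\<close>

lemma graph_iso_refl: "graph_iso F F"
  unfolding graph_iso_def by (intro exI[of _ id]) auto

lemma graph_iso_sym:
  assumes "graph_iso F H" shows "graph_iso H F"
proof -
  from assms obtain f where f: "bij_betw f (verts F) (verts H)"
    and e: "\<And>u v. u \<in> verts F \<Longrightarrow> v \<in> verts F \<Longrightarrow> {u, v} \<in> edges F \<longleftrightarrow> {f u, f v} \<in> edges H"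
    unfolding graph_iso_def by blast
  let ?g = "inv_into (verts F) f"
  have g: "bij_betw ?g (verts H) (verts F)" using f by (rule bij_betw_inv_into)
  have "{u, v} \<in> edges H \<longleftrightarrow> {?g u, ?g v} \<in> edges F" if "u \<in> verts H" "v \<in> verts H" for u v
    using e[of "?g u" "?g v"] that bij_betw_apply[OF g] bij_betw_inv_into_right[OF f] by simp
  with g show ?thesis unfolding graph_iso_def by blast
qed

lemma graph_iso_trans:
  assumes "graph_iso F H" "graph_iso H K" shows "graph_iso F K"
proof -
  from assms(1) obtain f where f: "bij_betw f (verts F) (verts H)"
    and e: "\<And>u v. u \<in> verts F \<Longrightarrow> v \<in> verts F \<Longrightarrow> {u, v} \<in> edges F \<longleftrightarrow> {f u, f v} \<in> edges H"
    unfolding graph_iso_def by blast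
  from assms(2) obtain g where g: "bij_betw g (verts H) (verts K)"
    and e': "\<And>u v. u \<in> verts H \<Longrightarrow> v \<in> verts H \<Longrightarrow> {u, v} \<in> edges H \<longleftrightarrow> {g u, g v} \<in> edges K"
    unfolding graph_iso_def by blast
  have "bij_betw (g \<circ> f) (verts F) (verts K)" using f g by (rule bij_betw_trans)
  moreover have "{u, v} \<in> edges F \<longleftrightarrow> {(g \<circ> f) u, (g \<circ> f) v} \<in> edges K"
    if "u \<in> verts F" "v \<in> verts F" for u v
    using e[OF that] e'[of "f u" "f v"] that bij_betw_apply[OF f] by simp
  ultimately show ?thesis unfolding graph_iso_def by blast
qed

lemma is_N_matrix_exists:
  assumes "simple_graph G" shows "\<exists>M. is_N_matrix G M"
proof -
  have reps: "\<exists>Fs. set Fs \<subseteq> S \<and> (\<forall>F \<in> S. \<exists>!i. i < length Fs \<and> graph_iso F (Fs ! i))"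
    if "finite S" for S :: "'a graph set"
    using that
  proof (induction S rule: finite_induct)
    case empty
    then show ?case by simp
  next
    case (insert F S)
    from insert.IH obtain Fs where Fs: "set Fs \<subseteq> S"
      "\<forall>H \<in> S. \<exists>!i. i < length Fs \<and> graph_iso H (Fs ! i)"
      by (elim exE conjE)
    show ?case
    proof (cases "\<exists>H \<in> S. graph_iso F H")
      case True
      then obtain H where H: "H \<in> S" "graph_iso F H" by blast
      have eq: "graph_iso F K = graph_iso H K" for K :: "'a graph"
        using graph_iso_trans[OF H(2), of K] graph_iso_trans[OF graph_iso_sym[OF H(2)], of K]
        by (rule iffI[rotated])
      have "\<exists>!i. i < length Fs \<and> graph_iso F (Fs ! i)"
        unfolding eq by (rule bspec[OF Fs(2) H(1)])
      with Fs have "set Fs \<subseteq> insert F S \<and>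
          (\<forall>H \<in> insert F S. \<exists>!i. i < length Fs \<and> graph_iso H (Fs ! i))"
        by (intro conjI ballI) (auto simp only: insert_iff)
      then show ?thesis by (rule exI)
    next
      case False
      have "\<exists>!i. i < length (F # Fs) \<and> graph_iso H ((F # Fs) ! i)" if H: "H \<in> insert F S" for H
      proof (cases "H = F")
        case True
        have not_iso: "\<not> graph_iso F (Fs ! i)" if "i < length Fs" for i
          using False Fs(1) that nth_mem by blast
        show ?thesis
        proof (rule ex1I)
          show "0 < length (F # Fs) \<and> graph_iso H ((F # Fs) ! 0)"
            by (simp add: True graph_iso_refl)
        next
          fix k assume k: "k < length (F # Fs) \<and> graph_iso H ((F # Fs) ! k)"
          show "k = 0"
          proof (cases k)
            case (Suc j)
            with k True not_iso[of j] show ?thesis by simp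
          qed
        qed
      next
        case neq: False
        with H have HS: "H \<in> S" by blast
        then have nF: "\<not> graph_iso H F" using False graph_iso_sym by blast
        from bspec[OF Fs(2) HS] obtain i where i: "i < length Fs \<and> graph_iso H (Fs ! i)"
          and uniq: "\<forall>j. j < length Fs \<and> graph_iso H (Fs ! j) \<longrightarrow> j = i"
          by (rule ex1E)
        show ?thesis
        proof (rule ex1I)
          show "Suc i < length (F # Fs) \<and> graph_iso H ((F # Fs) ! Suc i)" using i by simp
        next
          fix k assume k: "k < length (F # Fs) \<and> graph_iso H ((F # Fs) ! k)"
          show "k = Suc i"
          proof (cases k)
            case 0
            with k nF show ?thesis by simp
          next
            case (Suc j)
            with k have "j < length Fs \<and> graph_iso H (Fs ! j)" by simp
            with uniq Suc show ?thesis by simp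
          qed
        qed
      qed
      moreover have "set (F # Fs) \<subseteq> insert F S" using Fs(1) by auto
      ultimately show ?thesis by (intro exI[of _ "F # Fs"] conjI ballI)
    qed
  qed
  have "finite (induced_subgraphs G)"
    using assms unfolding induced_subgraphs_def simple_graph_def
    by (simp add: setcompr_eq_image flip: Pow_def)
  then have "finite {F \<in> induced_subgraphs G. edges F \<noteq> {}}" by simp
  from reps[OF this] obtain Fs where "set Fs \<subseteq> {F \<in> induced_subgraphs G. edges F \<noteq> {}}"
    "\<forall>F \<in> {F \<in> induced_subgraphs G. edges F \<noteq> {}}. \<exists>!i. i < length Fs \<and> graph_iso F (Fs ! i)"
    by (elim exE conjE)
  then have "enumerates_Lambda G Fs"
    unfolding enumerates_Lambda_def by (simp only: mem_Collect_eq Ball_def) simp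
  then show ?thesis
    unfolding is_N_matrix_def by (intro exI conjI, assumption) (rule refl)
qed


section \<open>The rank polynomial\<close>

definition connected_rel :: "'a graph \<Rightarrow> ('a \<times> 'a) set" where
  "connected_rel F = {(u, v). u \<in> verts F \<and> v \<in> verts F \<and> (u, v) \<in> {(x, y). {x, y} \<in> edges F}\<^sup>*}"

definition num_comps :: "'a graph \<Rightarrow> nat" where
  "num_comps F = card (verts F // connected_rel F)"

text \<open>The natural-number subtractions below do not truncate for finite simple graphs, since
  \<open>num_comps F \<le> v(F) \<le> e(F) + num_comps F\<close>.\<close>

definition graph_rank :: "'a graph \<Rightarrow> nat" where
  "graph_rank F = card (verts F) - num_comps F"

definition graph_corank :: "'a graph \<Rightarrow> nat" where
  "graph_corank F = card (edges F) + num_comps F - card (verts F)"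

definition subgraph :: "'a graph \<Rightarrow> 'a graph \<Rightarrow> bool" where
  "subgraph F G \<longleftrightarrow> simple_graph F \<and> verts F \<subseteq> verts G \<and> edges F \<subseteq> edges G"

definition no_isolated_vertices :: "'a graph \<Rightarrow> bool" where
  "no_isolated_vertices F \<longleftrightarrow> (\<forall>v \<in> verts F. \<exists>e \<in> edges F. v \<in> e)"

definition rho :: "'a graph \<Rightarrow> nat \<Rightarrow> nat \<Rightarrow> nat" where
  "rho G r s = card {F. subgraph F G \<and> no_isolated_vertices F \<and>
     graph_rank F = r \<and> graph_corank F = s}"

text \<open>A polynomial in \<open>x\<close> over the polynomials in \<open>y\<close>. All pairs with \<open>\<rho>\<^sub>r\<^sub>s \<noteq> 0\<close> lie in the range
  of summation, because the rank and co-rank of a subgraph add up to its number of edges.\<close>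

definition rank_poly :: "'a graph \<Rightarrow> int poly poly" where
  "rank_poly G = (\<Sum>r \<le> card (edges G). \<Sum>s \<le> card (edges G).
     monom (monom (int (rho G r s)) s) r)"

end

theory Submission imports Defs
begin

text \<open>
  Call a vertex set edgeful if it contains an edge, and match the edgeful vertex sets \<open>W\<close> of \<open>G\<close>
  and \<open>W'\<close> of \<open>G'\<close> whose types correspond under the permutation identifying the two matrices.
  Say that two set functions agree if they take equal values on matched sets. Equality of the
  matrices says precisely that agreement is preserved by summation over edgeful subsets; hence
  (Moebius inversion) it is also reflected by it. Since the sum over \<open>X \<subseteq> W\<close> of the cover product
  \<open>\<Sum>U \<union> V = X. f U * g V\<close> is the product of the sums of \<open>f\<close> and \<open>g\<close>, agreement is preserved
  by cover products, and, since the vertex numbers agree, by disjoint products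
  \<open>\<Sum>U \<union> V = W, U \<inter> V = {}. f U * g V\<close>.

  Let \<open>S\<^sub>q(W)\<close> (the constant \<open>potts\<close>) be the sum of \<open>y\<^bsup>|A|\<^esup> q\<^bsup>comp(A)\<^esup>\<close> over the edge sets \<open>A\<close> with
  \<open>\<Union>A = W\<close>. Its values for \<open>q = 1\<close> have sum \<open>(1 + y)\<^bsup>e(W)\<^esup> - 1\<close>, so they agree. As
  \<open>q\<^bsup>comp(A)\<^esup>\<close> counts the \<open>q\<close>-colourings constant on every component, splitting off one colour class
  expresses \<open>S\<close> at \<open>q + 1\<close> by \<open>S\<close> at \<open>1\<close> and \<open>q\<close> and their disjoint product, so all \<open>S\<^sub>q\<close> agree.
  Comparing coefficients, \<open>G\<close> and \<open>G'\<close> have equally many edge sets \<open>A\<close> with given \<open>|A|\<close>,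
  \<open>|\<Union>A|\<close> and \<open>comp(A)\<close>.
\<close>

section \<open>Matched edgeful sets\<close>

text \<open>For \<open>W\<close> inside \<open>verts G\<close>, these are the vertex sets whose
  induced subgraphs the matrix counts. Edgeless sets are excluded because no row or column records
  them.\<close>

definition edgeful :: "'a graph \<Rightarrow> 'a set \<Rightarrow> 'a set set" where
  "edgeful G W = {U. U \<subseteq> W \<and> (\<exists>e \<in> edges G. e \<subseteq> U)}"

lemma finite_edgeful: "finite W \<Longrightarrow> finite (edgeful G W)"
  by (rule finite_subset[of _ "Pow W"]) (auto simp: edgeful_def)

lemma edgeful_self: "U \<in> edgeful G W \<Longrightarrow> U \<in> edgeful G U"
  by (auto simp: edgeful_def)

lemma edgeful_mono: "U \<in> edgeful G W \<Longrightarrow> W \<subseteq> X \<Longrightarrow> U \<in> edgeful G X"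
  by (auto simp: edgeful_def)

text \<open>The union convolution of the subset lattice, restricted to edgeful sets: summation over
  subsets turns it into ordinary multiplication.\<close>

definition cover_prod ::
  "'a graph \<Rightarrow> ('a set \<Rightarrow> 'r) \<Rightarrow> ('a set \<Rightarrow> 'r) \<Rightarrow> 'a set \<Rightarrow> 'r::comm_ring_1" where
  "cover_prod G f g W =
     (\<Sum>(U, V) | U \<in> edgeful G W \<and> V \<in> edgeful G W \<and> U \<union> V = W. f U * g V)"

text \<open>Subset convolution over edgeful parts only. Terms with an empty part are treated
  separately, since matched sets always contain an edge.\<close>

definition disjoint_prod ::
  "'a graph \<Rightarrow> ('a set \<Rightarrow> 'r) \<Rightarrow> ('a set \<Rightarrow> 'r) \<Rightarrow> 'a set \<Rightarrow> 'r::comm_ring_1" where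
  "disjoint_prod G f g W =
     (\<Sum>U | U \<in> edgeful G W \<and> W - U \<in> edgeful G W. f U * g (W - U))"

text \<open>Every pair of edgeful subsets of \<open>W\<close> has exactly one union, again an
  edgeful subset of \<open>W\<close>. Grouping all pairs by their union leaves a product of two
  sums.\<close>

lemma sum_cover_prod:
  assumes "finite W"
  shows "(\<Sum>X \<in> edgeful G W. cover_prod G f g X) = sum f (edgeful G W) * sum g (edgeful G W)"
proof -
  let ?S = "edgeful G W \<times> edgeful G W"
  have "cover_prod G f g X = (\<Sum>x | x \<in> ?S \<and> fst x \<union> snd x = X. f (fst x) * g (snd x))"
    if "X \<in> edgeful G W" for X
    unfolding cover_prod_def using that
    by (intro sum.cong) (auto simp: edgeful_def case_prod_beta)
  then have "(\<Sum>X \<in> edgeful G W. cover_prod G f g X) =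
      (\<Sum>X \<in> edgeful G W. \<Sum>x | x \<in> ?S \<and> fst x \<union> snd x = X. f (fst x) * g (snd x))"
    by (intro sum.cong) simp_all
  also have "\<dots> = (\<Sum>x \<in> ?S. f (fst x) * g (snd x))"
    using assms by (intro sum.group) (auto simp: finite_edgeful, auto simp: edgeful_def)
  finally show ?thesis
    by (simp add: sum_product sum.cartesian_product case_prod_beta)
qed

text \<open>Two sets with union \<open>W\<close> are disjoint iff their sizes add up to
  \<open>card W\<close>. Prescribing both sizes therefore turns disjointness into a condition on
  each factor separately.\<close>

lemma disjoint_prod_eq_cover_prods:
  assumes "finite W"
  shows "disjoint_prod G f g W = (\<Sum>a \<le> card W. cover_prod G
    (\<lambda>U. if card U = a then f U else 0) (\<lambda>V. if card V = card W - a then g V else 0) W)"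
proof -
  let ?C = "{(U, V). U \<in> edgeful G W \<and> V \<in> edgeful G W \<and> U \<union> V = W}"
  have fin: "finite ?C"
    by (rule finite_subset[of _ "edgeful G W \<times> edgeful G W"]) (auto simp: finite_edgeful assms)
  have *: "(\<Sum>a \<le> card W. (if card U = a then f U else 0) * (if card V = card W - a then g V else 0))
      = (if U \<inter> V = {} then f U * g V else 0)"
    if "U \<union> V = W" for U V
  proof -
    have finU: "finite U" "finite V" using assms that by auto
    have le: "card U \<le> card W" using assms that by (intro card_mono) auto
    have "card V = card W - card U \<longleftrightarrow> U \<inter> V = {}"
      using card_Un_Int[OF finU] that le finU by (auto simp: card_eq_0_iff)
    moreover have "(\<Sum>a \<le> card W.
        (if card U = a then f U else 0) * (if card V = card W - a then g V else 0))
      = (\<Sum>a \<le> card W. if a = card U then f U * (if card V = card W - card U then g V else 0) else 0)"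
      by (intro sum.cong) auto
    ultimately show ?thesis using le by (simp add: sum.delta)
  qed
  have "(\<Sum>a \<le> card W. cover_prod G
    (\<lambda>U. if card U = a then f U else 0) (\<lambda>V. if card V = card W - a then g V else 0) W)
    = (\<Sum>(U, V) \<in> ?C. if U \<inter> V = {} then f U * g V else 0)"
    unfolding cover_prod_def
    by (subst sum.swap) (rule sum.cong[OF refl], use * in auto)
  also have "\<dots> = (\<Sum>(U, V) \<in> {(U, V) \<in> ?C. U \<inter> V = {}}. f U * g V)"
    using fin by (intro sum.mono_neutral_cong_right) (auto split: if_splits)
  also have "\<dots> = disjoint_prod G f g W"
  proof -
    have "{(U, V) \<in> ?C. U \<inter> V = {}} = (\<lambda>U. (U, W - U)) ` {U \<in> edgeful G W. W - U \<in> edgeful G W}" (is "?L = ?R")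
    proof (rule Set.set_eqI)
      fix x :: "'a set \<times> 'a set"
      obtain U V where x: "x = (U, V)" by (cases x)
      show "x \<in> ?L \<longleftrightarrow> x \<in> ?R"
      proof (cases "U \<subseteq> W")
        case True
        then have "U \<union> V = W \<and> U \<inter> V = {} \<longleftrightarrow> V = W - U" by blast
        then show ?thesis unfolding x by (simp add: image_iff) blast
      qed (auto simp: x edgeful_def)
    qed
    then show ?thesis
      unfolding disjoint_prod_def by (simp add: sum.reindex inj_on_def)
  qed
  finally show ?thesis by simp
qed

section \<open>Matched sets and sums over their edgeful subsets\<close>

text \<open>The labels \<open>t\<close> and \<open>t'\<close> are type indices in a common
  numbering, and \<open>count_type\<close> is the equality of the two matrices, entry by entry. No
  isomorphism enters the arguments made inside the locale.\<close>

locale type_matching =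
  fixes G :: "'a graph" and G' :: "'b graph" and t :: "'a set \<Rightarrow> nat" and t' :: "'b set \<Rightarrow> nat"
  assumes simple: "simple_graph G" and simple': "simple_graph G'"
    and count_type: "\<And>W W' j. W \<in> edgeful G (verts G) \<Longrightarrow> W' \<in> edgeful G' (verts G') \<Longrightarrow>
      t W = t' W' \<Longrightarrow>
      card {U \<in> edgeful G W. t U = j} = card {U' \<in> edgeful G' W'. t' U' = j}"
begin

lemma swap: "type_matching G' G t' t"
  using simple simple' by unfold_locales (simp_all add: count_type)

definition rel :: "'a set \<Rightarrow> 'b set \<Rightarrow> bool" where
  "rel W W' \<longleftrightarrow> W \<in> edgeful G (verts G) \<and> W' \<in> edgeful G' (verts G') \<and> t W = t' W'"

definition agree :: "('a set \<Rightarrow> 'r) \<Rightarrow> ('b set \<Rightarrow> 'r) \<Rightarrow> bool" where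
  "agree f f' \<longleftrightarrow> (\<forall>W W'. rel W W' \<longrightarrow> f W = f' W')"

lemma agreeD: "agree f f' \<Longrightarrow> rel W W' \<Longrightarrow> f W = f' W'"
  by (simp add: agree_def)

lemma rel_finite: "rel W W' \<Longrightarrow> finite W" "rel W W' \<Longrightarrow> finite W'"
  using simple simple' by (auto simp: rel_def edgeful_def simple_graph_def intro: finite_subset)

lemma rel_self: "rel W W' \<Longrightarrow> W \<in> edgeful G W" "rel W W' \<Longrightarrow> W' \<in> edgeful G' W'"
  by (auto simp: rel_def intro: edgeful_self)

lemma relI: "rel W W' \<Longrightarrow> U \<in> edgeful G W \<Longrightarrow> U' \<in> edgeful G' W' \<Longrightarrow> t U = t' U' \<Longrightarrow> rel U U'"
  by (auto simp: rel_def edgeful_def)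

lemma rel_ex:
  assumes "rel W W'" "U \<in> edgeful G W"
  shows "\<exists>U' \<in> edgeful G' W'. rel U U'"
proof -
  have "card {X \<in> edgeful G W. t X = t U} \<noteq> 0"
    using assms rel_finite[OF assms(1)] by (auto simp: card_eq_0_iff finite_edgeful)
  then have "card {X \<in> edgeful G' W'. t' X = t U} \<noteq> 0"
    using count_type[of W W' "t U"] assms by (simp add: rel_def)
  then obtain X where "X \<in> edgeful G' W'" "t' X = t U"
    by (metis (mono_tags, lifting) Collect_empty_eq card.empty)
  then show ?thesis using assms relI by metis
qed

text \<open>Group both sums by type: corresponding classes have equal size, and on them
  \<open>f\<close> and \<open>f'\<close> take one common value.\<close>

lemma sum_edgeful_eq:
  fixes f :: "'a set \<Rightarrow> 'r::comm_ring_1"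
  assumes f: "agree f f'" and W: "rel W W'"
  shows "sum f (edgeful G W) = sum f' (edgeful G' W')"
proof -
  note fin = finite_edgeful[OF rel_finite(1)[OF W], of G] finite_edgeful[OF rel_finite(2)[OF W], of G']
  let ?J = "t ` edgeful G W \<union> t' ` edgeful G' W'"
  have "sum f {U \<in> edgeful G W. t U = j} = sum f' {U' \<in> edgeful G' W'. t' U' = j}" for j
  proof -
    let ?A = "{U \<in> edgeful G W. t U = j}" and ?B = "{U' \<in> edgeful G' W'. t' U' = j}"
    have c: "card ?A = card ?B" using count_type[of W W' j] W by (simp add: rel_def)
    have finAB: "finite ?A" "finite ?B" using fin by simp_all
    show ?thesis
    proof (cases "?A = {}")
      case True
      have "?B = {}" using c finAB unfolding True by (simp only: card.empty card_eq_0_iff) auto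
      with True show ?thesis by (simp only: sum.empty)
    next
      case False
      then have "card ?A \<noteq> 0" using finAB(1) by simp
      then have "?B \<noteq> {}" unfolding c by (intro notI) (simp only: card.empty)
      then obtain U' where U': "U' \<in> ?B" by blast
      from False obtain U where U: "U \<in> ?A" by blast
      \<comment> \<open>All of \<open>?A\<close> is matched with the single set \<open>U'\<close>,
        so \<open>f\<close> is constant on \<open>?A\<close>; in the same way \<open>U\<close> makes
        \<open>f'\<close> constant on \<open>?B\<close>.\<close>
      have "sum f ?A = of_nat (card ?A) * f' U'"
        using U' agreeD[OF f relI[OF W, of _ U']] by (subst sum.cong[OF refl, of _ _ "\<lambda>_. f' U'"]) auto
      moreover have "sum f' ?B = of_nat (card ?B) * f' U'"
        using U' agreeD[OF f relI[OF W, of U], symmetric] U by (subst sum.cong[OF refl, of _ _ "\<lambda>_. f' U'"]) auto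
      ultimately show ?thesis unfolding c by simp
    qed
  qed
  then have "(\<Sum>j \<in> ?J. sum f {U \<in> edgeful G W. t U = j}) =
      (\<Sum>j \<in> ?J. sum f' {U' \<in> edgeful G' W'. t' U' = j})" by simp
  then show ?thesis using fin by (subst (asm) (1 2) sum.group) auto
qed

lemma agree_sum:
  fixes f :: "'a set \<Rightarrow> 'r::comm_ring_1"
  shows "agree f f' \<Longrightarrow> agree (\<lambda>W. sum f (edgeful G W)) (\<lambda>W'. sum f' (edgeful G' W'))"
  using sum_edgeful_eq unfolding agree_def by blast

lemma agree_card_edgeful: "agree (\<lambda>W. card (edgeful G W)) (\<lambda>W'. card (edgeful G' W'))"
proof -
  have "agree (\<lambda>W. 1::int) (\<lambda>W'. 1)" by (simp add: agree_def)
  from agree_sum[OF this] show ?thesis by (simp add: agree_def)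
qed

end

section \<open>Agreement of vertex numbers\<close>

lemma edgeful_card_ge_2:
  assumes "simple_graph G" "finite W" "W \<in> edgeful G X"
  shows "2 \<le> card W"
proof -
  obtain e where "e \<in> edges G" "e \<subseteq> W" using assms(3) by (auto simp: edgeful_def)
  then show ?thesis using assms(1) card_mono[OF assms(2), of e] by (simp add: simple_graph_def)
qed

text \<open>The number of edgeful subsets is already known to agree on matched sets, so a strict
  drop in it carries proper inclusion from one graph to the other before vertex numbers are
  compared.\<close>

lemma card_edgeful_less:
  assumes "finite W" "W \<in> edgeful G W" "U \<subset> W"
  shows "card (edgeful G U) < card (edgeful G W)"
proof (intro psubset_card_mono finite_edgeful psubsetI)
  show "edgeful G U \<subseteq> edgeful G W" using assms(3) by (auto simp: edgeful_def)
  have "W \<notin> edgeful G U" using assms(3) by (auto simp: edgeful_def)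
  then show "edgeful G U \<noteq> edgeful G W" using assms(2) by blast
qed fact

context type_matching
begin

text \<open>Deleting vertices off a chosen edge one at a time leads from \<open>W\<close> down to
  that edge through edgeful sets. A partner of a proper subset is again a proper subset, so
  \<open>W'\<close> is at least as large as \<open>W\<close>.\<close>

lemma card_le: "rel W W' \<Longrightarrow> card W \<le> card W'"
proof (induction "card W" arbitrary: W W' rule: less_induct)
  case less
  note fin = rel_finite[OF less.prems]
  show ?case
  proof (cases "card W = 2")
    case True
    then show ?thesis
      using edgeful_card_ge_2[OF simple' fin(2) rel_self(2)[OF less.prems]] by simp
  next
    case False
    obtain e where e: "e \<in> edges G" "e \<subseteq> W" "card e = 2"
      using rel_self[OF less.prems] simple by (auto simp: edgeful_def simple_graph_def)
    with False have "e \<noteq> W" by blast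
    with e obtain v where v: "v \<in> W" "v \<notin> e" by blast
    let ?U = "W - {v}"
    have U: "?U \<in> edgeful G W" using e v by (auto simp: edgeful_def)
    then obtain U' where U': "U' \<in> edgeful G' W'" "rel ?U U'"
      using rel_ex[OF less.prems] by blast
    have "card (edgeful G ?U) < card (edgeful G W)"
      using v by (intro card_edgeful_less fin rel_self[OF less.prems]) auto
    \<comment> \<open>The strict inequality passes to the partners and rules out
      \<open>U' = W'\<close>.\<close>
    then have "card (edgeful G' U') < card (edgeful G' W')"
      using agreeD[OF agree_card_edgeful] U'(2) less.prems by metis
    then have "U' \<subset> W'" using U'(1) by (auto simp: edgeful_def)
    then have "card U' < card W'" using fin by (simp add: psubset_card_mono)
    moreover have "card ?U < card W" using fin v by (intro card_Diff1_less)
    then have "card ?U \<le> card U'" using less.hyps U'(2) by blast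
    moreover have "card ?U = card W - 1" using v by (simp add: card_Diff_singleton)
    ultimately show ?thesis by simp
  qed
qed

lemma agree_card: "agree card card"
proof -
  interpret sw: type_matching G' G t' t by (rule swap)
  have "card W = card W'" if "rel W W'" for W W'
    using card_le[of W W'] sw.card_le[of W' W] that by (simp add: rel_def sw.rel_def)
  then show ?thesis by (simp add: agree_def)
qed

text \<open>Moebius inversion by induction on \<open>card W\<close>: the value at \<open>W\<close>
  is the full sum minus the values at the smaller edgeful subsets.\<close>

lemma agree_of_agree_sum:
  fixes h :: "'a set \<Rightarrow> 'r::comm_ring_1"
  assumes "agree (\<lambda>W. sum h (edgeful G W)) (\<lambda>W'. sum h' (edgeful G' W'))"
  shows "agree h h'"
proof -
  \<comment> \<open>Properness of \<open>Y\<close> is encoded by its cardinality inside the summand,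
    so that \<open>sum_edgeful_eq\<close> applies to the truncated function.\<close>
  have split: "sum k (edgeful H X) = k X + (\<Sum>Y \<in> edgeful H X. if card Y < card X then k Y else 0)"
    if "finite X" "X \<in> edgeful H X" for H :: "'c graph" and k :: "'c set \<Rightarrow> 'r" and X
  proof -
    have "(\<Sum>Y \<in> edgeful H X. if card Y < card X then k Y else 0) = sum k (edgeful H X - {X})"
    proof (intro sum.mono_neutral_cong_right finite_edgeful that ballI)
      fix Y assume Y: "Y \<in> edgeful H X - {X}"
      then have "Y \<subset> X" by (auto simp: edgeful_def)
      then have "card Y < card X" using that by (simp add: psubset_card_mono)
      then show "(if card Y < card X then k Y else 0) = k Y" by simp
    qed auto
    then show ?thesis using that by (simp add: sum.remove[of _ X] finite_edgeful)
  qed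
  have "h W = h' W'" if "rel W W'" for W W'
    using that
  proof (induction "card W" arbitrary: W W' rule: less_induct)
    case less
    have c: "card W = card W'" using less.prems agreeD[OF agree_card] by blast
    \<comment> \<open>Below the size of \<open>W\<close> this is the induction hypothesis, elsewhere
      both functions are 0; equal vertex numbers keep the two cases aligned.\<close>
    have "agree (\<lambda>X. if card X < card W then h X else 0) (\<lambda>X'. if card X' < card W' then h' X' else 0)"
      using less.hyps c agreeD[OF agree_card] by (auto simp: agree_def)
    from sum_edgeful_eq[OF this less.prems] agreeD[OF assms less.prems]
    show ?case
      using split[OF rel_finite(1)[OF less.prems] rel_self(1)[OF less.prems], of h]
        split[OF rel_finite(2)[OF less.prems] rel_self(2)[OF less.prems], of h'] by simp
  qed
  then show ?thesis by (simp add: agree_def)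
qed

section \<open>Agreement of products and of edge numbers\<close>

lemma agree_cover_prod:
  fixes f g :: "'a set \<Rightarrow> 'r::comm_ring_1"
  assumes "agree f f'" "agree g g'"
  shows "agree (cover_prod G f g) (cover_prod G' f' g')"
proof (rule agree_of_agree_sum, unfold agree_def, intro allI impI)
  fix W W' assume W: "rel W W'"
  show "sum (cover_prod G f g) (edgeful G W) = sum (cover_prod G' f' g') (edgeful G' W')"
    using W by (simp add: sum_cover_prod rel_finite sum_edgeful_eq[OF assms(1) W]
        sum_edgeful_eq[OF assms(2) W])
qed

text \<open>A cutoff by cardinality preserves agreement, so each cover product in the decomposition
  agrees; \<open>card W = card W'\<close> makes the ranges of summation equal.\<close>

lemma agree_disjoint_prod:
  fixes f g :: "'a set \<Rightarrow> 'r::comm_ring_1"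
  assumes "agree f f'" "agree g g'"
  shows "agree (disjoint_prod G f g) (disjoint_prod G' f' g')"
proof (unfold agree_def, intro allI impI)
  fix W W' assume W: "rel W W'"
  have restr: "agree (\<lambda>U. if card U = a then k U else 0) (\<lambda>U. if card U = a then k' U else 0)"
    if "agree k k'" for a and k :: "'a set \<Rightarrow> 'r" and k'
    using that agree_card by (simp add: agree_def)
  show "disjoint_prod G f g W = disjoint_prod G' f' g' W'"
    unfolding disjoint_prod_eq_cover_prods[OF rel_finite(1)[OF W]]
      disjoint_prod_eq_cover_prods[OF rel_finite(2)[OF W]] agreeD[OF agree_card W]
    by (intro sum.cong refl agreeD[OF agree_cover_prod W] restr assms)
qed

text \<open>Edges are precisely the edgeful sets with two vertices, so their number is a sum over
  edgeful subsets of a function of the cardinality.\<close>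

lemma agree_num_edges:
  "agree (\<lambda>W. card {e \<in> edges G. e \<subseteq> W}) (\<lambda>W'. card {e \<in> edges G'. e \<subseteq> W'})"
proof -
  have *: "int (card {e \<in> edges H. e \<subseteq> X}) = (\<Sum>U \<in> edgeful H X. if card U = 2 then 1 else 0)"
    if "simple_graph H" "finite X" for H :: "'c graph" and X
  proof -
    have "{e \<in> edges H. e \<subseteq> X} = {U \<in> edgeful H X. card U = 2}"
    proof (intro equalityI subsetI)
      fix U assume "U \<in> {U \<in> edgeful H X. card U = 2}"
      then obtain e where "U \<subseteq> X" "card U = 2" "e \<in> edges H" "e \<subseteq> U"
        by (auto simp: edgeful_def)
      moreover from this have "e = U"
        using that card_subset_eq[of U e] finite_subset[of U X] by (auto simp: simple_graph_def)
      ultimately show "U \<in> {e \<in> edges H. e \<subseteq> X}" by simp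
    qed (use that in \<open>auto simp: edgeful_def simple_graph_def\<close>)
    then show ?thesis using that by (simp add: finite_edgeful flip: sum.inter_filter)
  qed
  have "agree (\<lambda>U. if card U = 2 then 1 else 0 :: int) (\<lambda>U. if card U = 2 then 1 else 0)"
    using agree_card by (simp add: agree_def)
  note agreeD[OF agree_sum[OF this]]
  then have "int (card {e \<in> edges G. e \<subseteq> W}) = int (card {e \<in> edges G'. e \<subseteq> W'})" if "rel W W'" for W W'
    using that unfolding *[OF simple rel_finite(1)[OF that]] *[OF simple' rel_finite(2)[OF that]] .
  then show ?thesis by (simp add: agree_def)
qed

end

section \<open>Edge covers and colourings\<close>

definition edge_covers :: "'a graph \<Rightarrow> 'a set \<Rightarrow> 'a set set set" where
  "edge_covers G W = {A. A \<subseteq> edges G \<and> \<Union>A = W}"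

text \<open>These are constant on edges, the opposite of proper colourings. The value
  \<open>undefined\<close> outside \<open>\<Union>A\<close> makes them functions on the covered
  vertices only.\<close>

definition colourings :: "nat \<Rightarrow> 'a set set \<Rightarrow> ('a \<Rightarrow> nat) set" where
  "colourings q A = {c \<in> \<Union>A \<rightarrow>\<^sub>E {..<q}. \<forall>e \<in> A. \<forall>u \<in> e. \<forall>v \<in> e. c u = c v}"

text \<open>The Fortuin-Kasteleyn form of the Potts partition function, restricted to edge sets
  covering exactly \<open>W\<close>. Counting colourings instead of writing a power of
  \<open>q\<close> makes the recursion in \<open>q\<close> a statement about colour classes.\<close>

definition potts :: "'r::comm_ring_1 \<Rightarrow> 'a graph \<Rightarrow> nat \<Rightarrow> 'a set \<Rightarrow> 'r" where
  "potts y G q W = (\<Sum>A \<in> edge_covers G W. y ^ card A * of_nat (card (colourings q A)))"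

lemma finite_edges: "simple_graph G \<Longrightarrow> finite (edges G)"
  by (rule finite_subset[of _ "Pow (verts G)"]) (auto simp: simple_graph_def)

lemma empty_not_edge: "simple_graph G \<Longrightarrow> {} \<notin> edges G"
  by (auto simp: simple_graph_def)

lemma finite_edge_covers: "simple_graph G \<Longrightarrow> finite (edge_covers G W)"
  by (rule finite_subset[of _ "Pow (edges G)"]) (auto simp: edge_covers_def finite_edges)

text \<open>A nonempty edge set inside \<open>W\<close> covers exactly one edgeful set, namely its
  union. The empty edge set is left out because its union contains no edge.\<close>

lemma sum_edge_covers:
  assumes "simple_graph G" "finite W"
  shows "(\<Sum>X \<in> edgeful G W. \<Sum>A \<in> edge_covers G X. F A) =
    sum F (Pow {e \<in> edges G. e \<subseteq> W} - {{}})"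
proof -
  let ?S = "Pow {e \<in> edges G. e \<subseteq> W} - {{}}"
  have "edge_covers G X = {A \<in> ?S. \<Union>A = X}" if "X \<in> edgeful G W" for X
    using that assms empty_not_edge[OF assms(1)] by (auto simp: edge_covers_def edgeful_def)
  then have "(\<Sum>X \<in> edgeful G W. \<Sum>A \<in> edge_covers G X. F A) =
      (\<Sum>X \<in> edgeful G W. \<Sum>A | A \<in> ?S \<and> \<Union>A = X. F A)"
    by (intro sum.cong) simp_all
  also have "\<dots> = sum F ?S"
    by (intro sum.group) (auto simp: finite_edges assms finite_edgeful, auto simp: edgeful_def)
  finally show ?thesis .
qed

section \<open>Colourings and the recursion in the number of colours\<close>

lemma colouringsD:
  assumes "c \<in> colourings q A"
  shows "e \<in> A \<Longrightarrow> u \<in> e \<Longrightarrow> v \<in> e \<Longrightarrow> c u = c v"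
    and "v \<in> \<Union>A \<Longrightarrow> c v < q"
    and "v \<notin> \<Union>A \<Longrightarrow> c v = undefined"
  using assms unfolding colourings_def PiE_iff extensional_def by blast+

lemma colouringsI:
  assumes "\<And>e u v. e \<in> A \<Longrightarrow> u \<in> e \<Longrightarrow> v \<in> e \<Longrightarrow> c u = c v"
    and "\<And>v. v \<in> \<Union>A \<Longrightarrow> c v < q"
    and "\<And>v. v \<notin> \<Union>A \<Longrightarrow> c v = undefined"
  shows "c \<in> colourings q A"
  using assms unfolding colourings_def PiE_iff extensional_def by blast

lemma finite_colourings:
  assumes "finite (\<Union>A)"
  shows "finite (colourings q A)"
  by (rule finite_subset[of _ "\<Union>A \<rightarrow>\<^sub>E {..<q}"]) (auto simp: colourings_def finite_PiE assms)

lemma colourings_one: "colourings 1 A = {\<lambda>v. if v \<in> \<Union>A then 0 else undefined}"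
proof (intro equalityI subsetI)
  fix c assume c: "c \<in> colourings 1 A"
  have "c v = (if v \<in> \<Union>A then 0 else undefined)" for v
    using colouringsD(2)[OF c, of v] colouringsD(3)[OF c, of v] by simp
  then show "c \<in> {\<lambda>v. if v \<in> \<Union>A then 0 else undefined}" by (simp only: singleton_iff fun_eq_iff) blast
qed (auto intro!: colouringsI)

text \<open>The set \<open>U\<close> is the last colour class.\<close>

lemma card_colourings_Suc:
  assumes "finite (\<Union>A)"
  shows "card (colourings (Suc q) A) = (\<Sum>U \<in> Pow (\<Union>A).
    if \<forall>e \<in> A. e \<subseteq> U \<or> e \<inter> U = {} then card (colourings q {e \<in> A. e \<inter> U = {}}) else 0)"
proof -
  let ?last = "\<lambda>c. {v \<in> \<Union>A. c v = q}"
  let ?C = "\<lambda>U. {c \<in> colourings (Suc q) A. ?last c = U}"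
  have "card (colourings (Suc q) A) = (\<Sum>U \<in> Pow (\<Union>A). \<Sum>c \<in> ?C U. 1)"
    by (subst sum.group) (auto simp: finite_colourings assms)
  also have "\<dots> = (\<Sum>U \<in> Pow (\<Union>A).
    if \<forall>e \<in> A. e \<subseteq> U \<or> e \<inter> U = {} then card (colourings q {e \<in> A. e \<inter> U = {}}) else 0)"
  proof (rule sum.cong[OF refl])
    fix U assume U: "U \<in> Pow (\<Union>A)"
    let ?B = "{e \<in> A. e \<inter> U = {}}"
    show "(\<Sum>c \<in> ?C U. 1) = (if \<forall>e \<in> A. e \<subseteq> U \<or> e \<inter> U = {} then card (colourings q ?B) else 0)"
    proof (cases "\<forall>e \<in> A. e \<subseteq> U \<or> e \<inter> U = {}")
      case True
      \<comment> \<open>Separation puts each covered vertex outside \<open>U\<close> on an edge that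
        avoids \<open>U\<close>, so dropping the other edges loses no vertex there.\<close>
      have UB: "\<Union>?B = \<Union>A - U" using True by blast
      have "bij_betw (\<lambda>c. restrict c (\<Union>A - U)) (?C U) (colourings q ?B)"
      proof (rule bij_betw_byWitness[where f' = "\<lambda>d v. if v \<in> U then q else d v"])
        show "\<forall>c \<in> ?C U. (\<lambda>v. if v \<in> U then q else restrict c (\<Union>A - U) v) = c"
          by (auto simp: fun_eq_iff dest: colouringsD(3))
        show "\<forall>d \<in> colourings q ?B. restrict (\<lambda>v. if v \<in> U then q else d v) (\<Union>A - U) = d"
        proof (rule ballI, rule ext)
          fix d v assume "d \<in> colourings q ?B"
          from colouringsD(3)[OF this, of v]
          show "restrict (\<lambda>v. if v \<in> U then q else d v) (\<Union>A - U) v = d v"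
            unfolding UB by (simp add: restrict_def)
        qed
        show "(\<lambda>c. restrict c (\<Union>A - U)) ` ?C U \<subseteq> colourings q ?B"
        proof (rule image_subsetI)
          fix c assume c: "c \<in> ?C U"
          show "restrict c (\<Union>A - U) \<in> colourings q ?B"
          proof (rule colouringsI, unfold UB)
            fix e u v assume e: "e \<in> ?B" "u \<in> e" "v \<in> e"
            then have "u \<in> \<Union>A - U" "v \<in> \<Union>A - U" by blast+
            then show "restrict c (\<Union>A - U) u = restrict c (\<Union>A - U) v"
              using c e colouringsD(1)[of c "Suc q" A e u v] by simp
          next
            fix v assume v: "v \<in> \<Union>A - U"
            then have "c v < Suc q" using c colouringsD(2)[of c "Suc q" A v] by simp
            moreover have "c v \<noteq> q" using c v by blast
            ultimately show "restrict c (\<Union>A - U) v < q" using v by simp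
          next
            fix v assume "v \<notin> \<Union>A - U"
            then show "restrict c (\<Union>A - U) v = undefined" by (simp only: restrict_def if_False)
          qed
        qed
        show "(\<lambda>d v. if v \<in> U then q else d v) ` colourings q ?B \<subseteq> ?C U"
        proof (rule image_subsetI)
          fix d assume d: "d \<in> colourings q ?B"
          have lt: "d v < q" if "v \<in> \<Union>A - U" for v
            using colouringsD(2)[OF d] that unfolding UB by simp
          have und: "d v = undefined" if "v \<notin> \<Union>A - U" for v
            using colouringsD(3)[OF d] that unfolding UB by simp
          let ?c = "\<lambda>v. if v \<in> U then q else d v"
          have "?c \<in> colourings (Suc q) A"
          proof (rule colouringsI)
            fix e u v assume e: "e \<in> A" "u \<in> e" "v \<in> e"
            show "?c u = ?c v"
            proof (cases "e \<subseteq> U")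
              case False
              then have eB: "e \<in> ?B" using True e(1) by blast
              then have "u \<notin> U" "v \<notin> U" using e by blast+
              then show ?thesis using colouringsD(1)[OF d eB e(2,3)] by simp
            qed (use e in auto)
          next
            fix v show "v \<in> \<Union>A \<Longrightarrow> ?c v < Suc q" using lt[of v] by auto
          next
            fix v assume v: "v \<notin> \<Union>A"
            then have "v \<notin> U" "v \<notin> \<Union>A - U" using U by blast+
            then show "?c v = undefined" using und by simp
          qed
          moreover have "?last ?c = U"
          proof (rule Set.set_eqI)
            fix v show "v \<in> ?last ?c \<longleftrightarrow> v \<in> U" using lt[of v] U by auto
          qed
          ultimately show "?c \<in> ?C U" by blast
        qed
      qed
      then have "card (?C U) = card (colourings q ?B)" by (rule bij_betw_same_card)
      with True show ?thesis by simp
    next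
      case False
      then obtain e u v where e: "e \<in> A" "u \<in> e" "v \<in> e" "u \<in> U" "v \<notin> U" by blast
      \<comment> \<open>An edge meeting both \<open>U\<close> and its complement would carry the
        colour \<open>q\<close> and another one.\<close>
      have "c \<notin> ?C U" for c
      proof
        assume c: "c \<in> ?C U"
        then have "c u = c v" using e colouringsD(1)[of c "Suc q" A e u v] by blast
        moreover have "c u = q" "c v \<noteq> q" using c e by blast+
        ultimately show False by simp
      qed
      then have "?C U = {}" by blast
      with False show ?thesis by (simp only: sum.empty if_False)
    qed
  qed
  finally show ?thesis .
qed

text \<open>The last colour class \<open>U\<close> splits each edge set into a cover of
  \<open>U\<close> and a cover of \<open>W - U\<close>. The vertices of \<open>U\<close> have no
  further choice of colour, whence the parameter 1; the others use the remaining \<open>q\<close>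
  colours.\<close>

lemma potts_Suc:
  assumes G: "simple_graph G" and W: "finite W"
  shows "potts y G (Suc q) W = (\<Sum>U \<in> Pow W. potts y G 1 U * potts y G q (W - U))"
proof -
  let ?sep = "\<lambda>A U. \<forall>e \<in> A. e \<subseteq> U \<or> e \<inter> U = {}"
  let ?w = "\<lambda>A U. y ^ card A * of_nat (card (colourings q {e \<in> A. e \<inter> U = {}}))"
  have "potts y G (Suc q) W =
      (\<Sum>A \<in> edge_covers G W. \<Sum>U \<in> Pow W. if ?sep A U then ?w A U else 0)"
    unfolding potts_def
  proof (rule sum.cong[OF refl])
    fix A assume "A \<in> edge_covers G W"
    then have "\<Union>A = W" by (simp add: edge_covers_def)
    then show "y ^ card A * of_nat (card (colourings (Suc q) A)) =
        (\<Sum>U \<in> Pow W. if ?sep A U then ?w A U else 0)"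
      using card_colourings_Suc[of A q] W
      by (simp add: sum_distrib_left if_distrib cong: if_cong)
  qed
  also have "\<dots> = (\<Sum>U \<in> Pow W. \<Sum>A \<in> edge_covers G W. if ?sep A U then ?w A U else 0)"
    by (rule sum.swap)
  also have "\<dots> = (\<Sum>U \<in> Pow W. potts y G 1 U * potts y G q (W - U))"
  proof (rule sum.cong[OF refl])
    fix U assume U: "U \<in> Pow W"
    let ?P = "edge_covers G U \<times> edge_covers G (W - U)"
    \<comment> \<open>An empty edge would both lie in \<open>U\<close> and avoid \<open>U\<close>,
      so the splitting would not be unique.\<close>
    have ne: "{} \<notin> A" if "A \<subseteq> edges G" for A using empty_not_edge[OF G] that by blast
    have split: "{e \<in> A \<union> B. Q e} = B" if "\<forall>e \<in> A. \<not> Q e" "\<forall>e \<in> B. Q e"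
      for A B :: "'a set set" and Q
      using that by blast
    have part: "{e \<in> A \<union> B. e \<inter> U = {}} = B" "{e \<in> A \<union> B. e \<subseteq> U} = A" "A \<inter> B = {}"
      if "(A, B) \<in> ?P" for A B
    proof -
      have "e \<subseteq> U" "e \<noteq> {}" if "e \<in> A" for e
        using \<open>(A, B) \<in> ?P\<close> that ne[of A] by (auto simp: edge_covers_def)
      then have A: "e \<subseteq> U" "e \<inter> U \<noteq> {}" if "e \<in> A" for e
        using that by blast+
      have "e \<subseteq> W - U" "e \<noteq> {}" if "e \<in> B" for e
        using \<open>(A, B) \<in> ?P\<close> that ne[of B] by (auto simp: edge_covers_def)
      then have B: "e \<inter> U = {}" "\<not> e \<subseteq> U" if "e \<in> B" for e
        using that by blast+
      show "{e \<in> A \<union> B. e \<inter> U = {}} = B" by (rule split) (simp_all add: A B)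
      show "{e \<in> A \<union> B. e \<subseteq> U} = A" by (subst Un_commute, rule split) (simp_all add: A B)
      show "A \<inter> B = {}" using A(1) B(2) by blast
    qed
    have "(\<Sum>A \<in> edge_covers G W. if ?sep A U then ?w A U else 0) =
        (\<Sum>A | A \<in> edge_covers G W \<and> ?sep A U. ?w A U)"
      by (simp add: sum.inter_filter finite_edge_covers G)
    also have "{A \<in> edge_covers G W. ?sep A U} = (\<lambda>(A, B). A \<union> B) ` ?P"
    proof (intro equalityI subsetI)
      fix A assume A: "A \<in> {A \<in> edge_covers G W. ?sep A U}"
      then have "\<Union>A = W" "\<forall>e \<in> A. e \<subseteq> U \<or> e \<inter> U = {}" by (simp_all add: edge_covers_def)
      then have "\<Union>{e \<in> A. e \<subseteq> U} = U" "\<Union>{e \<in> A. e \<inter> U = {}} = W - U"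
        using U by blast+
      then have "({e \<in> A. e \<subseteq> U}, {e \<in> A. e \<inter> U = {}}) \<in> ?P"
        using A by (auto simp: edge_covers_def)
      moreover have "A = {e \<in> A. e \<subseteq> U} \<union> {e \<in> A. e \<inter> U = {}}" using A by blast
      ultimately show "A \<in> (\<lambda>(A, B). A \<union> B) ` ?P" by (metis (no_types, lifting) case_prod_conv image_eqI)
    next
      fix A assume "A \<in> (\<lambda>(A, B). A \<union> B) ` ?P"
      then show "A \<in> {A \<in> edge_covers G W. ?sep A U}" using U by (auto simp: edge_covers_def)
    qed
    also have "(\<Sum>A \<in> (\<lambda>(A, B). A \<union> B) ` ?P. ?w A U) = (\<Sum>(A, B) \<in> ?P. ?w (A \<union> B) U)"
    proof (subst sum.reindex)
      \<comment> \<open>Both parts are recovered from the union by their position relative to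
        \<open>U\<close>.\<close>
      show "inj_on (\<lambda>(A, B). A \<union> B) ?P"
        by (rule inj_on_inverseI[where g = "\<lambda>A. ({e \<in> A. e \<subseteq> U}, {e \<in> A. e \<inter> U = {}})"])
          (use part in \<open>simp only: case_prod_beta mem_Times_iff fst_conv snd_conv split_paired_all\<close>)
    qed (simp add: case_prod_beta comp_def)
    also have "\<dots> = (\<Sum>(A, B) \<in> ?P. y ^ card A * (y ^ card B * of_nat (card (colourings q B))))"
    proof (rule sum.cong[OF refl], clarify)
      fix A B assume "A \<in> edge_covers G U" "B \<in> edge_covers G (W - U)"
      then have AB: "(A, B) \<in> ?P" by simp
      then have "finite A" "finite B" using finite_edges[OF G] by (auto simp: edge_covers_def intro: finite_subset)
      then have "card (A \<union> B) = card A + card B" using part[OF AB] by (intro card_Un_disjoint)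
      then show "?w (A \<union> B) U = y ^ card A * (y ^ card B * of_nat (card (colourings q B)))"
        unfolding part[OF AB] by (simp add: power_add mult.assoc)
    qed
    also have "\<dots> = potts y G 1 U * potts y G q (W - U)"
      by (simp add: potts_def colourings_one sum_product sum.cartesian_product case_prod_beta del: One_nat_def)
    finally show "(\<Sum>A \<in> edge_covers G W. if ?sep A U then ?w A U else 0) =
      potts y G 1 U * potts y G q (W - U)" .
  qed
  finally show ?thesis .
qed

text \<open>The empty edge set has exactly one colouring, the function \<open>undefined\<close>
  everywhere, even for \<open>q = 0\<close>.\<close>

lemma potts_empty:
  fixes G :: "'a graph"
  assumes "simple_graph G"
  shows "potts y G q {} = 1"
proof -
  have "edge_covers G {} = {{}}"
    using empty_not_edge[OF assms] by (auto simp: edge_covers_def)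
  moreover have "colourings q {} = {\<lambda>_ :: 'a. undefined}"
    by (auto simp: colourings_def)
  ultimately show ?thesis unfolding potts_def by simp
qed

lemma potts_not_edgeful:
  assumes "W \<notin> edgeful G W" "W \<noteq> {}"
  shows "potts y G q W = 0"
proof -
  have "edge_covers G W = {}"
    using assms by (auto simp: edge_covers_def edgeful_def)
  then show ?thesis by (simp add: potts_def)
qed

lemma potts_0:
  assumes "W \<noteq> {}"
  shows "potts y G 0 W = 0"
proof -
  have "colourings 0 A = {}" if "A \<in> edge_covers G W" for A
    using that assms by (auto simp: colourings_def edge_covers_def PiE_iff)
  then show ?thesis by (simp add: potts_def)
qed

text \<open>For \<open>U = {}\<close> and \<open>U = W\<close> one part is empty, hence not edgeful,
  yet it contributes the factor 1; these two terms are split off. Any other class contributes 0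
  unless both parts are edgeful.\<close>

lemma potts_Suc_disjoint_prod:
  assumes G: "simple_graph G" and W: "finite W" "W \<noteq> {}"
  shows "potts y G (Suc q) W =
    potts y G 1 W + potts y G q W + disjoint_prod G (potts y G 1) (potts y G q) W"
proof -
  let ?f = "\<lambda>U. potts y G 1 U * potts y G q (W - U)"
  let ?D = "{U. U \<in> edgeful G W \<and> W - U \<in> edgeful G W}"
  have D: "?D \<subseteq> Pow W - {{}} - {W}" using empty_not_edge[OF G] by (auto simp: edgeful_def)
  have "potts y G (Suc q) W = ?f {} + (?f W + sum ?f (Pow W - {{}} - {W}))"
    unfolding potts_Suc[OF G W(1)]
    using W by (subst sum.remove[of _ "{}"], simp, simp, subst sum.remove[of _ W]) simp_all
  also have "sum ?f (Pow W - {{}} - {W}) = sum ?f ?D"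
  proof (rule sum.mono_neutral_right)
    show "\<forall>U \<in> Pow W - {{}} - {W} - ?D. ?f U = 0"
    proof
      fix U assume U: "U \<in> Pow W - {{}} - {W} - ?D"
      then have "U \<notin> edgeful G U \<or> W - U \<notin> edgeful G (W - U)"
        using edgeful_mono[of U G U W] edgeful_mono[of "W - U" G "W - U" W] by auto
      moreover have "U \<noteq> {}" "W - U \<noteq> {}" using U by auto
      ultimately show "?f U = 0" using potts_not_edgeful by (metis mult_zero_left mult_zero_right)
    qed
  qed (use W D in auto)
  finally show ?thesis by (simp add: potts_empty[OF G] disjoint_prod_def algebra_simps)
qed

lemma (in type_matching) rel_nonempty: "rel W W' \<Longrightarrow> W \<noteq> {}" "rel W W' \<Longrightarrow> W' \<noteq> {}"
  using empty_not_edge[OF simple] empty_not_edge[OF simple'] by (auto simp: rel_def edgeful_def)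

text \<open>With one colour only the sizes of the edge sets count, and the binomial expansion sums
  \<open>y ^ card A\<close> over all of them. The subtracted 1 belongs to the empty edge
  set.\<close>

lemma sum_potts_one:
  assumes "simple_graph G" "finite W"
  shows "sum (potts y G 1) (edgeful G W) = (1 + y) ^ card {e \<in> edges G. e \<subseteq> W} - 1"
proof -
  let ?E = "{e \<in> edges G. e \<subseteq> W}"
  have fin: "finite ?E" using finite_edges[OF assms(1)] by simp
  have "sum (potts y G 1) (edgeful G W) = (\<Sum>A \<in> Pow ?E - {{}}. y ^ card A)"
    using sum_edge_covers[OF assms, of "\<lambda>A. y ^ card A"]
    by (simp add: potts_def colourings_one del: One_nat_def)
  also have "\<dots> = (\<Sum>A \<in> Pow ?E. y ^ card A) - 1"
    using fin by (simp add: sum_diff1)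
  also have "(\<Sum>A \<in> Pow ?E. y ^ card A) = (1 + y) ^ card ?E"
    using prod_add[OF fin, of "\<lambda>_. y" "\<lambda>_. 1"] by (simp add: add.commute)
  finally show ?thesis .
qed

lemma (in type_matching) agree_potts: "agree (potts y G q) (potts y G' q)"
proof -
  have one: "agree (potts y G 1) (potts y G' 1)"
  proof (rule agree_of_agree_sum, unfold agree_def, intro allI impI)
    fix W W' assume W: "rel W W'"
    show "sum (potts y G 1) (edgeful G W) = sum (potts y G' 1) (edgeful G' W')"
      using agreeD[OF agree_num_edges W] rel_finite[OF W] simple simple'
      by (simp add: sum_potts_one del: One_nat_def)
  qed
  show ?thesis
  proof (induction q)
    case 0
    show ?case by (auto simp: agree_def potts_0 rel_nonempty)
  next
    case (Suc q)
    show ?case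
    proof (unfold agree_def, intro allI impI)
      fix W W' assume W: "rel W W'"
      show "potts y G (Suc q) W = potts y G' (Suc q) W'"
        using agreeD[OF one W] agreeD[OF Suc W] agreeD[OF agree_disjoint_prod[OF one Suc] W]
          rel_finite[OF W] rel_nonempty[OF W] simple simple'
        by (simp add: potts_Suc_disjoint_prod del: One_nat_def)
    qed
  qed
qed

section \<open>Components and the rank polynomial\<close>

definition comps :: "'a set set \<Rightarrow> nat" where
  "comps A = num_comps (\<Union>A, A)"

lemma comps_empty: "comps {} = 0"
  by (simp add: comps_def num_comps_def)

text \<open>A colouring constant on edges is constant along paths, so it amounts to a free choice of
  colour for each component.\<close>

lemma card_colourings:
  assumes "finite A" and A2: "\<And>e. e \<in> A \<Longrightarrow> card e = 2"
  shows "card (colourings q A) = q ^ comps A"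
proof -
  let ?V = "\<Union>A" and ?E = "{(x, y). {x, y} \<in> A}"
  let ?r = "connected_rel (?V, A)"
  have r: "?r = {(u, v). u \<in> ?V \<and> v \<in> ?V \<and> (u, v) \<in> ?E\<^sup>*}" by (simp add: connected_rel_def)
  have "finite e" if "e \<in> A" for e using A2[OF that] by (intro card_ge_0_finite) simp
  then have finV: "finite ?V" using \<open>finite A\<close> by blast
  have symE: "sym (?E\<^sup>*)" by (intro sym_rtrancl symI) (simp add: insert_commute)
  have eq: "equiv ?V ?r"
    unfolding r by (rule equivI)
      (auto simp: refl_on_def intro!: symI transI dest: symD[OF symE] intro: rtrancl_trans)
  have fin: "finite (?V // ?r)" using finV by (rule finite_quotient) (auto simp: r)
  have edge: "?r `` {u} = ?r `` {v}" if "e \<in> A" "u \<in> e" "v \<in> e" for e u v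
  proof -
    have "u = v \<or> {u, v} = e"
      using A2[OF that(1)] that(2,3) by (auto simp: card_2_iff)
    then have "(u, v) \<in> ?E\<^sup>*" using that(1) by auto
    then have "(u, v) \<in> ?r" using that unfolding r by blast
    then show ?thesis by (rule equiv_class_eq[OF eq])
  qed
  have const: "c u = c v" if "c \<in> colourings q A" "(u, v) \<in> ?E\<^sup>*" for c u v
    using that(2)
  proof (induction rule: rtrancl_induct)
    case (step v w)
    then have "c v = c w" using colouringsD(1)[OF that(1), of "{v, w}" v w] by simp
    with step.IH show ?case by simp
  qed simp
  let ?f = "\<lambda>g. \<lambda>v \<in> ?V. g (?r `` {v})"
  have "bij_betw ?f ((?V // ?r) \<rightarrow>\<^sub>E {..<q}) (colourings q A)"
  proof (rule bij_betw_imageI)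
    show "inj_on ?f ((?V // ?r) \<rightarrow>\<^sub>E {..<q})"
    proof (rule inj_onI)
      fix g h assume g: "g \<in> (?V // ?r) \<rightarrow>\<^sub>E {..<q}" and h: "h \<in> (?V // ?r) \<rightarrow>\<^sub>E {..<q}"
        and gh: "?f g = ?f h"
      show "g = h"
      proof (rule PiE_ext[OF g h])
        fix X assume "X \<in> ?V // ?r"
        then obtain v where v: "v \<in> ?V" "X = ?r `` {v}" by (rule quotientE)
        then show "g X = h X" using fun_cong[OF gh, of v] by (simp only: restrict_apply if_True)
      qed
    qed
    show "?f ` ((?V // ?r) \<rightarrow>\<^sub>E {..<q}) = colourings q A"
    proof (intro equalityI subsetI)
      fix c assume "c \<in> ?f ` ((?V // ?r) \<rightarrow>\<^sub>E {..<q})"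
      then obtain g where g: "g \<in> (?V // ?r) \<rightarrow>\<^sub>E {..<q}" "c = ?f g" by blast
      show "c \<in> colourings q A"
      proof (rule colouringsI)
        fix e u v assume e: "e \<in> A" "u \<in> e" "v \<in> e"
        then have "u \<in> ?V" "v \<in> ?V" by blast+
        then show "c u = c v" using edge[OF e] g(2) by (simp only: restrict_apply if_True)
      next
        fix v assume v: "v \<in> ?V"
        then have "?r `` {v} \<in> ?V // ?r" by (rule quotientI)
        then have "g (?r `` {v}) \<in> {..<q}" by (rule PiE_mem[OF g(1)])
        then show "c v < q" using g(2) v by (simp only: restrict_apply if_True lessThan_iff)
      next
        fix v assume "v \<notin> ?V"
        then show "c v = undefined" using g(2) by (simp only: restrict_apply if_False)
      qed
    next
      fix c assume c: "c \<in> colourings q A"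
      \<comment> \<open>The preimage assigns to a component the single value that \<open>c\<close>
        takes on it.\<close>
      let ?g = "\<lambda>X \<in> ?V // ?r. the_elem (c ` X)"
      have g: "?g (?r `` {v}) = c v" if "v \<in> ?V" for v
      proof -
        have "c ` (?r `` {v}) = {c v}"
          using that const[OF c] unfolding r by (auto simp: image_iff)
        moreover have "?r `` {v} \<in> ?V // ?r" using that by (rule quotientI)
        ultimately show ?thesis by simp
      qed
      have "?g \<in> (?V // ?r) \<rightarrow>\<^sub>E {..<q}"
      proof (rule PiE_I)
        fix X assume "X \<in> ?V // ?r"
        then obtain v where v: "v \<in> ?V" "X = ?r `` {v}" by (rule quotientE)
        show "?g X \<in> {..<q}" using g[OF v(1)] colouringsD(2)[OF c v(1)] unfolding v(2) by simp
      qed (simp only: restrict_apply if_False)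
      moreover have "c = ?f ?g"
      proof
        fix v show "c v = ?f ?g v"
        proof (cases "v \<in> ?V")
          case True
          then show ?thesis using g by (simp only: restrict_apply[of _ ?V] if_True)
        next
          case False
          then show ?thesis using colouringsD(3)[OF c] by (simp only: restrict_apply[of _ ?V] if_False)
        qed
      qed
      ultimately show "c \<in> ?f ` ((?V // ?r) \<rightarrow>\<^sub>E {..<q})" by (rule image_eqI[of c ?f ?g, rotated])
    qed
  qed
  then have "card (colourings q A) = card ((?V // ?r) \<rightarrow>\<^sub>E {..<q})" by (simp add: bij_betw_same_card)
  then show ?thesis using fin by (simp add: card_funcsetE comps_def num_comps_def)
qed

section \<open>Counts of edge sets by comparison of coefficients\<close>

text \<open>The power sums are values at \<open>q\<close> of integer polynomials whose coefficients
  are the desired counts. Agreement at infinitely many integers makes the polynomials equal.\<close>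

lemma card_eq_if_power_sums_eq:
  fixes f :: "'a \<Rightarrow> nat" and g :: "'b \<Rightarrow> nat"
  assumes "finite S" "finite T" and eq: "\<And>q :: nat. (\<Sum>x \<in> S. q ^ f x) = (\<Sum>x \<in> T. q ^ g x)"
  shows "card {x \<in> S. f x = c} = card {x \<in> T. g x = c}"
proof -
  define P where "P = (\<Sum>x \<in> S. monom (1::int) (f x))"
  define Q where "Q = (\<Sum>x \<in> T. monom (1::int) (g x))"
  have "poly P (int q) = poly Q (int q)" for q
    using arg_cong[OF eq[of q], of int] by (simp add: P_def Q_def poly_sum poly_monom)
  then have "range int \<subseteq> {x. poly (P - Q) x = 0}" by auto
  then have "infinite {x. poly (P - Q) x = 0}"
    using infinite_UNIV_nat range_inj_infinite[of int] by (auto dest: finite_subset)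
  then have "P = Q" using poly_roots_finite[of "P - Q"] by auto
  moreover have "coeff P c = card {x \<in> S. f x = c}" "coeff Q c = card {x \<in> T. g x = c}"
    using assms by (simp_all add: P_def Q_def coeff_sum flip: sum.inter_filter)
  ultimately show ?thesis by simp
qed

text \<open>Restricting to sets \<open>W\<close> of size \<open>n\<close> keeps track of the number
  of covered vertices, which summation over all \<open>W\<close> would lose.\<close>

lemma sum_potts_of_card:
  assumes "simple_graph G"
  shows "(\<Sum>W \<in> edgeful G (verts G). if card W = n then potts y G q W else 0) =
    (\<Sum>A \<in> Pow (edges G) - {{}}. if card (\<Union>A) = n then y ^ card A * of_nat (q ^ comps A) else 0)"
proof -
  let ?F = "\<lambda>A. if card (\<Union>A) = n then y ^ card A * of_nat (q ^ comps A) else 0"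
  have "(if card W = n then potts y G q W else 0) = sum ?F (edge_covers G W)" for W
  proof -
    have "?F A = (if card W = n then y ^ card A * of_nat (card (colourings q A)) else 0)"
      if "A \<in> edge_covers G W" for A
      using that assms card_colourings[of A q] finite_subset[OF _ finite_edges[OF assms], of A]
      by (auto simp: edge_covers_def simple_graph_def subset_iff)
    then show ?thesis by (simp add: potts_def)
  qed
  moreover have "{e \<in> edges G. e \<subseteq> verts G} = edges G" "finite (verts G)"
    using assms by (auto simp: simple_graph_def)
  ultimately show ?thesis using sum_edge_covers[OF assms, of "verts G" ?F] by simp
qed

text \<open>Rank and co-rank of an edge set are functions of these three numbers.\<close>

abbreviation profile :: "'a set set \<Rightarrow> nat \<times> nat \<times> nat" where
  "profile A \<equiv> (card A, card (\<Union>A), comps A)"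

lemma (in type_matching) card_profile_eq:
  assumes top: "rel (verts G) (verts G')"
  shows "card {A \<in> Pow (edges G). profile A = x} = card {A \<in> Pow (edges G'). profile A = x}"
proof -
  obtain k n c where x: "x = (k, n, c)" by (cases x)
  let ?S = "\<lambda>E. {A \<in> Pow E - {{}}. card (\<Union>A) = n \<and> card A = k}"
  note fin = finite_edges[OF simple] finite_edges[OF simple']
  have "card {A \<in> ?S (edges G). comps A = c} = card {A \<in> ?S (edges G'). comps A = c}"
  proof (rule card_eq_if_power_sums_eq)
    fix q
    \<comment> \<open>Taking the indeterminate for \<open>y\<close> makes the coefficient at
      \<open>k\<close> select the edge sets of size \<open>k\<close>.\<close>
    let ?y = "monom (1::int) 1"
    let ?F = "\<lambda>A. if card (\<Union>A) = n then ?y ^ card A * of_nat (q ^ comps A) else 0"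
    have "agree (\<lambda>W. if card W = n then potts ?y G q W else 0)
        (\<lambda>W. if card W = n then potts ?y G' q W else 0)"
      using agree_card agree_potts[of ?y q] by (simp add: agree_def)
    from sum_edgeful_eq[OF this top]
    have "sum ?F (Pow (edges G) - {{}}) = sum ?F (Pow (edges G') - {{}})"
      by (simp only: sum_potts_of_card simple simple')
    from arg_cong[OF this, of "\<lambda>p. coeff p k"]
    have "(\<Sum>A \<in> Pow (edges G) - {{}}. coeff (?F A) k) = (\<Sum>A \<in> Pow (edges G') - {{}}. coeff (?F A) k)"
      by (simp only: coeff_sum)
    moreover have *: "(\<Sum>A \<in> Pow E - {{}}. coeff (?F A) k) = int (\<Sum>A \<in> ?S E. q ^ comps A)"
      if "finite E" for E :: "'c set set"
    proof -
      have coeff: "coeff (?F A) k = (if card (\<Union>A) = n \<and> card A = k then int (q ^ comps A) else 0)"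
        for A :: "'c set set"
        by (simp add: monom_power of_nat_poly del: of_nat_power)
      have "(\<Sum>A \<in> Pow E - {{}}. coeff (?F A) k) = (\<Sum>A \<in> ?S E. int (q ^ comps A))"
        unfolding coeff using that by (intro sum.mono_neutral_cong_right) auto
      then show ?thesis by (simp only: of_nat_sum)
    qed
    ultimately have "int (\<Sum>A \<in> ?S (edges G). q ^ comps A) = int (\<Sum>A \<in> ?S (edges G'). q ^ comps A)"
      by (simp only: *[OF fin(1)] *[OF fin(2)])
    then show "(\<Sum>A \<in> ?S (edges G). q ^ comps A) = (\<Sum>A \<in> ?S (edges G'). q ^ comps A)"
      by (simp only: of_nat_eq_iff)
  qed (use fin in auto)
  \<comment> \<open>The sums ran over nonempty edge sets; the empty one has profile
    \<open>(0, 0, 0)\<close> in both graphs.\<close>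
  moreover have **: "card {A \<in> Pow E. profile A = x} =
      card {A \<in> ?S E. comps A = c} + (if x = (0, 0, 0) then 1 else 0)"
    if "finite E" for E :: "'c set set"
  proof -
    have "{A \<in> Pow E. profile A = x} =
        {A \<in> ?S E. comps A = c} \<union> (if x = (0, 0, 0) then {{}} else {})"
      by (auto simp: x comps_empty)
    then show ?thesis using that by (simp add: card_insert_if)
  qed
  ultimately show ?thesis by (simp only: **[OF fin(1)] **[OF fin(2)])
qed

lemma card_Collect_eq_if_fibres_eq:
  assumes "finite S" "finite T" "\<And>x. card {a \<in> S. f a = x} = card {b \<in> T. g b = x}"
  shows "card {a \<in> S. P (f a)} = card {b \<in> T. P (g b)}"
proof -
  let ?X = "f ` S \<union> g ` T"
  have *: "card {a \<in> R. P (h a)} = (\<Sum>x \<in> {x \<in> ?X. P x}. card {a \<in> R. h a = x})"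
    if "finite R" "h ` R \<subseteq> ?X" for R :: "'d set" and h
  proof -
    have "card {a \<in> R. P (h a)} = (\<Sum>x \<in> {x \<in> ?X. P x}. \<Sum>a | a \<in> {a \<in> R. P (h a)} \<and> h a = x. 1)"
      using assms(1,2) that by (subst sum.group) auto
    also have "\<dots> = (\<Sum>x \<in> {x \<in> ?X. P x}. card {a \<in> R. h a = x})"
      by (intro sum.cong refl) (auto intro: arg_cong[of _ _ card])
    finally show ?thesis .
  qed
  show ?thesis using *[of S f] *[of T g] assms by simp
qed

text \<open>A subgraph without isolated vertices is determined by its edge set, its vertices being
  the covered ones.\<close>

lemma rho_eq_card_edge_sets:
  assumes "simple_graph G"
  shows "rho G r s = card {A \<in> Pow (edges G). card (\<Union>A) - comps A = r \<and>
    card A + comps A - card (\<Union>A) = s}"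
proof -
  let ?R = "{A \<in> Pow (edges G). card (\<Union>A) - comps A = r \<and> card A + comps A - card (\<Union>A) = s}"
  have "{F. subgraph F G \<and> no_isolated_vertices F \<and> graph_rank F = r \<and> graph_corank F = s} =
      (\<lambda>A. (\<Union>A, A)) ` ?R"
  proof (intro equalityI subsetI)
    fix F assume F: "F \<in> {F. subgraph F G \<and> no_isolated_vertices F \<and> graph_rank F = r \<and> graph_corank F = s}"
    then have "verts F = \<Union>(edges F)"
      by (auto simp: subgraph_def simple_graph_def no_isolated_vertices_def)
    then have "F = (\<Union>(edges F), edges F)" by (metis prod.collapse)
    moreover from this have "edges F \<in> ?R"
      using F unfolding graph_rank_def graph_corank_def comps_def subgraph_def by (metis (mono_tags, lifting) PowI fst_conv mem_Collect_eq snd_conv)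
    ultimately show "F \<in> (\<lambda>A. (\<Union>A, A)) ` ?R" by blast
  next
    fix F assume "F \<in> (\<lambda>A. (\<Union>A, A)) ` ?R"
    then obtain A where A: "F = (\<Union>A, A)" "A \<in> ?R" by blast
    then have "A \<subseteq> edges G" by simp
    then have "finite (\<Union>A)" "\<Union>A \<subseteq> verts G" "\<forall>e \<in> A. card e = 2"
      using assms by (auto simp: simple_graph_def intro: finite_subset[of _ "verts G"])
    then show "F \<in> {F. subgraph F G \<and> no_isolated_vertices F \<and> graph_rank F = r \<and> graph_corank F = s}"
      using A by (auto simp: subgraph_def simple_graph_def no_isolated_vertices_def
          graph_rank_def graph_corank_def comps_def)
  qed
  then show ?thesis
    unfolding rho_def by (simp add: card_image inj_on_def)
qed

lemma (in type_matching) rank_poly_eq: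
  assumes top: "rel (verts G) (verts G')"
  shows "rank_poly G = rank_poly G'"
proof -
  have "rho G r s = rho G' r s" for r s
    unfolding rho_eq_card_edge_sets[OF simple] rho_eq_card_edge_sets[OF simple']
    using card_Collect_eq_if_fibres_eq[where f = profile and g = profile
        and S = "Pow (edges G)" and T = "Pow (edges G')"
        and P = "\<lambda>(k, n, c). n - c = r \<and> k + c - n = s"] card_profile_eq[OF top]
      finite_edges[OF simple] finite_edges[OF simple'] by simp
  \<comment> \<open>The number of edges is the bound of both summations in
    \<open>rank_poly\<close>.\<close>
  moreover have "card (edges G) = card (edges G')"
  proof -
    have "{e \<in> edges G. e \<subseteq> verts G} = edges G" "{e \<in> edges G'. e \<subseteq> verts G'} = edges G'"
      using simple simple' by (auto simp: simple_graph_def)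
    then show ?thesis using agreeD[OF agree_num_edges top] by simp
  qed
  ultimately show ?thesis by (simp add: rank_poly_def)
qed

section \<open>The matching given by the matrices\<close>

lemma verts_induced [simp]: "verts (induced G W) = W"
  by (simp add: induced_def)

lemma edges_induced: "edges (induced G W) = {e \<in> edges G. e \<subseteq> W}"
  by (simp add: induced_def)

lemma edgeful_iff: "U \<in> edgeful G W \<longleftrightarrow> U \<subseteq> W \<and> edges (induced G U) \<noteq> {}"
  by (auto simp: edgeful_def edges_induced)

text \<open>Inducing twice is inducing once, and \<open>induced G\<close> is injective because it
  remembers the vertex set; so counting subgraphs is counting vertex sets.\<close>

lemma induced_count_induced:
  "induced_count (induced G W) F = card {U \<in> Pow W. graph_iso (induced G U) F}"
proof -
  have "induced (induced G W) U = induced G U" if "U \<subseteq> W" for U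
    using that by (auto simp: induced_def)
  then have "induced_subgraphs (induced G W) = induced G ` Pow W"
    unfolding induced_subgraphs_def setcompr_eq_image Pow_def verts_induced
    by (intro image_cong) simp_all
  then have "{H \<in> induced_subgraphs (induced G W). graph_iso H F} =
      induced G ` {U \<in> Pow W. graph_iso (induced G U) F}"
    by (simp only: image_iff Set.set_eq_iff mem_Collect_eq) blast
  moreover have "inj_on (induced G) X" for X
    by (rule inj_on_inverseI[of _ verts]) simp
  ultimately show ?thesis unfolding induced_count_def by (simp only: card_image)
qed

lemma card_eq_if_graph_iso: "graph_iso (induced G W) (induced H X) \<Longrightarrow> card W = card X"
  by (auto simp: graph_iso_def dest: bij_betw_same_card)

lemma graph_iso_cong_left:
  assumes "graph_iso F H"
  shows "graph_iso F K \<longleftrightarrow> graph_iso H K"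
  using graph_iso_trans[OF assms] graph_iso_trans[OF graph_iso_sym[OF assms]] by (rule iffI[rotated])

text \<open>An isomorphism carries vertex subsets to vertex subsets with isomorphic induced graphs.
  This permits passing from \<open>W\<close> to the listed representative of its type.\<close>

lemma induced_count_cong:
  assumes "graph_iso (induced G W) (induced H X)"
  shows "induced_count (induced G W) F = induced_count (induced H X) F"
proof -
  obtain f where f: "bij_betw f W X"
    and e: "\<And>u v. u \<in> W \<Longrightarrow> v \<in> W \<Longrightarrow>
      {u, v} \<in> edges (induced G W) \<longleftrightarrow> {f u, f v} \<in> edges (induced H X)"
    using assms unfolding graph_iso_def verts_induced by blast
  have iso: "graph_iso (induced G U) (induced H (f ` U))" if U: "U \<subseteq> W" for U
    unfolding graph_iso_def verts_induced
  proof (intro exI conjI ballI)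
    show "bij_betw f U (f ` U)" using f U by (rule bij_betw_subset) simp
    fix u v assume uv: "u \<in> U" "v \<in> U"
    then have "f u \<in> X" "f v \<in> X" using U f bij_betwE by blast+
    then show "{u, v} \<in> edges (induced G U) \<longleftrightarrow> {f u, f v} \<in> edges (induced H (f ` U))"
      using e[of u v] uv U by (auto simp: edges_induced)
  qed
  have "bij_betw ((`) f) {U \<in> Pow W. graph_iso (induced G U) F}
      {Y \<in> Pow X. graph_iso (induced H Y) F}"
  proof (rule bij_betw_subset[OF bij_betw_Pow[OF f]])
    have "(`) f ` {U \<in> Pow W. graph_iso (induced H (f ` U)) F} =
        {Y \<in> (`) f ` Pow W. graph_iso (induced H Y) F}"
      by blast
    also have "(`) f ` Pow W = Pow X"
      using bij_betw_Pow[OF f] by (simp add: bij_betw_def)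
    also have "{U \<in> Pow W. graph_iso (induced H (f ` U)) F} = {U \<in> Pow W. graph_iso (induced G U) F}"
      using graph_iso_cong_left[OF iso] by blast
    finally show "(`) f ` {U \<in> Pow W. graph_iso (induced G U) F} =
        {Y \<in> Pow X. graph_iso (induced H Y) F}" .
  qed blast
  then show ?thesis unfolding induced_count_induced by (rule bij_betw_same_card)
qed

lemma edges_nonempty_if_graph_iso:
  assumes "simple_graph G" "graph_iso (induced G U) F" "edges (induced G U) \<noteq> {}"
  shows "edges F \<noteq> {}"
proof -
  obtain e where e: "e \<in> edges G" "e \<subseteq> U" using assms(3) by (auto simp: edges_induced)
  then obtain u v where "e = {u, v}" using assms(1) by (auto simp: simple_graph_def card_2_iff)
  with e show ?thesis using assms(2) by (auto simp: graph_iso_def edges_induced)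
qed

section \<open>Type indices and the rows of the matrix\<close>

definition iso_type :: "'a graph list \<Rightarrow> 'a graph \<Rightarrow> nat" where
  "iso_type Fs F = (THE i. i < length Fs \<and> graph_iso F (Fs ! i))"

context
  fixes G :: "'a graph" and Fs :: "'a graph list"
  assumes simple: "simple_graph G" and enum: "enumerates_Lambda G Fs"
begin

lemma iso_type_eq_iff:
  assumes "W \<in> edgeful G (verts G)"
  shows "iso_type Fs (induced G W) = i \<longleftrightarrow> i < length Fs \<and> graph_iso (induced G W) (Fs ! i)"
proof -
  have "\<exists>!i. i < length Fs \<and> graph_iso (induced G W) (Fs ! i)"
    using enum assms unfolding enumerates_Lambda_def edgeful_iff induced_subgraphs_def by blast
  from theI'[OF this] this show ?thesis unfolding iso_type_def by blast
qed

lemma iso_typeD: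
  assumes "W \<in> edgeful G (verts G)"
  shows "iso_type Fs (induced G W) < length Fs"
    and "graph_iso (induced G W) (Fs ! iso_type Fs (induced G W))"
  using iso_type_eq_iff[OF assms] by blast+

lemma representative:
  assumes "i < length Fs"
  obtains X where "X \<in> edgeful G (verts G)" "Fs ! i = induced G X" "iso_type Fs (induced G X) = i"
proof -
  have "Fs ! i \<in> induced_subgraphs G" "edges (Fs ! i) \<noteq> {}"
    using enum nth_mem[OF assms] unfolding enumerates_Lambda_def by blast+
  moreover from this(1) obtain X where X: "Fs ! i = induced G X" "X \<subseteq> verts G"
    by (auto simp: induced_subgraphs_def)
  ultimately have XV: "X \<in> edgeful G (verts G)" by (simp add: edgeful_iff)
  have "iso_type Fs (induced G X) = i"
    unfolding iso_type_eq_iff[OF XV] using assms by (simp add: X(1) graph_iso_refl)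
  with XV X(1) show thesis by (rule that)
qed

text \<open>Translates a matrix entry into a count of edgeful subsets by type, the form that
  \<open>count_type\<close> requires. The representative of the row is replaced by the isomorphic
  graph induced on \<open>W\<close>.\<close>

lemma induced_count_eq_card_iso_type:
  assumes W: "W \<in> edgeful G (verts G)" and j: "j < length Fs"
  shows "induced_count (Fs ! iso_type Fs (induced G W)) (Fs ! j) =
    card {U \<in> edgeful G W. iso_type Fs (induced G U) = j}"
proof -
  obtain X where X: "Fs ! iso_type Fs (induced G W) = induced G X"
    using representative[OF iso_typeD(1)[OF W]] by metis
  have "induced_count (Fs ! iso_type Fs (induced G W)) (Fs ! j) = induced_count (induced G W) (Fs ! j)"
    using iso_typeD(2)[OF W] unfolding X by (rule induced_count_cong[symmetric])
  also have "\<dots> = card {U \<in> Pow W. graph_iso (induced G U) (Fs ! j)}"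
    by (rule induced_count_induced)
  also have "{U \<in> Pow W. graph_iso (induced G U) (Fs ! j)} =
      {U \<in> edgeful G W. iso_type Fs (induced G U) = j}"
  proof (intro equalityI subsetI)
    fix U assume U: "U \<in> {U \<in> Pow W. graph_iso (induced G U) (Fs ! j)}"
    obtain Y where Y: "Y \<in> edgeful G (verts G)" "Fs ! j = induced G Y" using representative[OF j] by metis
    have "graph_iso (induced G Y) (induced G U)"
      by (rule graph_iso_sym) (use U Y(2) in simp)
    then have "edges (induced G U) \<noteq> {}"
      using edges_nonempty_if_graph_iso[OF simple, of Y] Y(1) by (simp add: edgeful_iff)
    then have UW: "U \<in> edgeful G W" using U by (simp add: edgeful_iff)
    moreover have "U \<in> edgeful G (verts G)" using edgeful_mono[OF UW] W by (auto simp: edgeful_def)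
    ultimately show "U \<in> {U \<in> edgeful G W. iso_type Fs (induced G U) = j}"
      using U j by (simp add: iso_type_eq_iff)
  next
    fix U assume U: "U \<in> {U \<in> edgeful G W. iso_type Fs (induced G U) = j}"
    then have "U \<in> edgeful G (verts G)" using W by (auto simp: edgeful_def)
    then show "U \<in> {U \<in> Pow W. graph_iso (induced G U) (Fs ! j)}"
      using U by (auto simp: iso_type_eq_iff edgeful_def)
  qed
  finally show ?thesis .
qed

text \<open>Every listed type occurs in \<open>G\<close>, so the row of \<open>G\<close> itself has
  no zero entry, a property that survives permutation of the matrix.\<close>

lemma induced_count_top_pos:
  assumes "verts G \<in> edgeful G (verts G)" "j < length Fs"
  shows "0 < induced_count (Fs ! iso_type Fs (induced G (verts G))) (Fs ! j)"
proof -
  obtain X where X: "X \<in> edgeful G (verts G)" "iso_type Fs (induced G X) = j"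
    using representative[OF assms(2)] by metis
  have "finite (verts G)" using simple by (simp add: simple_graph_def)
  then show ?thesis
    unfolding induced_count_eq_card_iso_type[OF assms] using X by (auto simp: card_gt_0_iff finite_edgeful)
qed

text \<open>A positive entry in the column of \<open>G\<close> gives a copy of \<open>G\<close>
  inside \<open>W\<close>, and finiteness leaves only the whole vertex set.\<close>

lemma eq_verts_if_induced_count_pos:
  assumes V: "verts G \<in> edgeful G (verts G)" and W: "W \<in> edgeful G (verts G)"
    and pos: "\<And>j. j < length Fs \<Longrightarrow> 0 < induced_count (Fs ! iso_type Fs (induced G W)) (Fs ! j)"
  shows "W = verts G"
proof -
  let ?j = "iso_type Fs (induced G (verts G))"
  have fin: "finite (verts G)" using simple by (simp add: simple_graph_def)
  have "0 < card {U \<in> edgeful G W. iso_type Fs (induced G U) = ?j}"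
    using pos[of ?j] iso_typeD(1)[OF V] induced_count_eq_card_iso_type[OF W] by simp
  then obtain U where U: "U \<in> edgeful G W" "iso_type Fs (induced G U) = ?j"
    by (auto simp: card_gt_0_iff)
  have UV: "U \<in> edgeful G (verts G)" using U(1) W by (auto simp: edgeful_def)
  have "graph_iso (induced G U) (induced G (verts G))"
    using iso_typeD(2)[OF UV] graph_iso_sym[OF iso_typeD(2)[OF V]] unfolding U(2) by (rule graph_iso_trans)
  then have "card U = card (verts G)" by (rule card_eq_if_graph_iso)
  then have "U = verts G" using UV fin by (intro card_subset_eq) (auto simp: edgeful_def)
  then show ?thesis using U(1) W by (auto simp: edgeful_def)
qed

end

lemma verts_edgeful: "simple_graph G \<Longrightarrow> edges G \<noteq> {} \<Longrightarrow> verts G \<in> edgeful G (verts G)"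
  by (auto simp: edgeful_def simple_graph_def)

text \<open>The permutation is absorbed into the labels on the side of \<open>G\<close>. The full
  vertex sets are matched because each belongs to the row without zeros.\<close>

lemma type_matching_if_N_matrix_eq:
  assumes G: "simple_graph G" "edges G \<noteq> {}" and G': "simple_graph G'" "edges G' \<noteq> {}"
    and N: "is_N_matrix G M" and N': "is_N_matrix G' M'" and eq: "unlabelled_eq M M'"
  obtains t t' where "type_matching G G' t t'" "t (verts G) = t' (verts G')"
proof -
  obtain Fs where Fs: "enumerates_Lambda G Fs"
    and M: "M = mat (length Fs) (length Fs) (\<lambda>(i, j). induced_count (Fs ! i) (Fs ! j))"
    using N unfolding is_N_matrix_def by blast
  obtain Fs' where Fs': "enumerates_Lambda G' Fs'"
    and M': "M' = mat (length Fs') (length Fs') (\<lambda>(i, j). induced_count (Fs' ! i) (Fs' ! j))"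
    using N' unfolding is_N_matrix_def by blast
  obtain n p where n: "M \<in> carrier_mat n n" "M' \<in> carrier_mat n n" and p: "p permutes {..<n}"
    and MM': "\<And>i j. i < n \<Longrightarrow> j < n \<Longrightarrow> M' $$ (p i, p j) = M $$ (i, j)"
    using eq unfolding unlabelled_eq_def by blast
  have len: "length Fs = n" "length Fs' = n" using n M M' by auto
  have p_less: "p i < n \<longleftrightarrow> i < n" for i using permutes_in_image[OF p, of i] by simp
  have cnt: "induced_count (Fs' ! p i) (Fs' ! p j) = induced_count (Fs ! i) (Fs ! j)"
    if "i < n" "j < n" for i j
    using MM'[OF that] that p_less by (simp add: M M' len)
  let ?s = "\<lambda>W. iso_type Fs (induced G W)" and ?t' = "\<lambda>W. iso_type Fs' (induced G' W)"
  let ?V = "verts G" and ?V' = "verts G'"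
  note V = verts_edgeful[OF G] and V' = verts_edgeful[OF G']
  have "type_matching G G' (\<lambda>W. p (?s W)) ?t'"
  proof
    fix W W' j assume W: "W \<in> edgeful G ?V" and W': "W' \<in> edgeful G' ?V'" and t: "p (?s W) = ?t' W'"
    show "card {U \<in> edgeful G W. p (?s U) = j} = card {U' \<in> edgeful G' W'. ?t' U' = j}"
    proof (cases "j < n")
      case True
      obtain i where i: "p i = j" using permutes_surj[OF p] by (metis surjD)
      then have "i < n" using True p_less[of i] by simp
      have "p (?s U) = j \<longleftrightarrow> ?s U = i" for U
        using i permutes_inj[OF p] by (auto dest: injD)
      then have "card {U \<in> edgeful G W. p (?s U) = j} = induced_count (Fs ! ?s W) (Fs ! i)"
        using induced_count_eq_card_iso_type[OF G(1) Fs W] \<open>i < n\<close> len by simp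
      also have "\<dots> = induced_count (Fs' ! ?t' W') (Fs' ! j)"
        using cnt[of "?s W" i] iso_typeD(1)[OF G(1) Fs W] \<open>i < n\<close> len t i by simp
      also have "\<dots> = card {U' \<in> edgeful G' W'. ?t' U' = j}"
        using induced_count_eq_card_iso_type[OF G'(1) Fs' W'] True len by simp
      finally show ?thesis .
    next
      case False
      \<comment> \<open>Indices from \<open>n\<close> on label no edgeful set, as \<open>p\<close>
        keeps indices below \<open>n\<close> below \<open>n\<close>.\<close>
      have "p (?s U) \<noteq> j" if "U \<in> edgeful G W" for U
      proof -
        have "U \<in> edgeful G ?V" using that W by (auto simp: edgeful_def)
        then show ?thesis using iso_typeD(1)[OF G(1) Fs] False len p_less by metis
      qed
      moreover have "?t' U \<noteq> j" if "U \<in> edgeful G' W'" for U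
      proof -
        have "U \<in> edgeful G' ?V'" using that W' by (auto simp: edgeful_def)
        then show ?thesis using iso_typeD(1)[OF G'(1) Fs'] False len by metis
      qed
      ultimately have "{U \<in> edgeful G W. p (?s U) = j} = {}" "{U' \<in> edgeful G' W'. ?t' U' = j} = {}"
        by blast+
      then show ?thesis by (simp only: card.empty)
    qed
  qed (rule G G')+
  moreover have "p (?s ?V) = ?t' ?V'"
  proof -
    have sV: "?s ?V < n" using iso_typeD(1)[OF G(1) Fs V] len by simp
    then obtain X where X: "X \<in> edgeful G' ?V'" "?t' X = p (?s ?V)"
      using representative[OF G'(1) Fs', of "p (?s ?V)"] p_less len by metis
    \<comment> \<open>The row of \<open>X\<close> is the permuted row of \<open>G\<close>, so all
      its entries are positive.\<close>
    have "X = ?V'"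
    proof (rule eq_verts_if_induced_count_pos[OF G'(1) Fs' V' X(1)])
      fix j assume j: "j < length Fs'"
      obtain i where i: "p i = j" using permutes_surj[OF p] by (metis surjD)
      then have "i < n" using j p_less[of i] len by simp
      then show "0 < induced_count (Fs' ! ?t' X) (Fs' ! j)"
        using cnt[OF sV, of "i"] induced_count_top_pos[OF G(1) Fs V, of "i"] len
        unfolding X(2) i by simp
    qed
    with X show ?thesis by simp
  qed
  ultimately show thesis by (rule that)
qed

theorem theorem3p15:
  fixes G :: "'a graph" and G' :: "'b graph" and M M' :: "nat mat"
  assumes "simple_graph G" and "edges G \<noteq> {}"
    and "simple_graph G'" and "edges G' \<noteq> {}"
    and "is_N_matrix G M" and "is_N_matrix G' M'"
    and "unlabelled_eq M M'"
  shows "rank_poly G = rank_poly G'"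
proof -
  obtain t t' where tm: "type_matching G G' t t'" and top: "t (verts G) = t' (verts G')"
    using type_matching_if_N_matrix_eq[OF assms] .
  interpret type_matching G G' t t' by (rule tm)
  show ?thesis
    by (rule rank_poly_eq) (simp add: rel_def top verts_edgeful assms)
qed

end
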